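(* Let $A$ be a commutative algebra over the field $\mathbb{Q}((q))$ of formal Laurent series, let $F(t)\in A[[t]]$ with $F(0)=0$, and let $\psi=q^m$ with $m\in\mathbb{Z}\setminus\{0\}$. Then: (i) for all $k\ge0$, $F^{[k]^*_{\psi}}=F^{[k]_{\psi^{-1}}}$; (ii) for every $G(t)\in A[[t]]$, $G[F]^*_{\psi}=G[F]_{\psi^{-1}}$; (iii) $\mathbf{E}_{\psi}[F]^*_{\psi}=\mathbf{e}_{\psi^{-1}}[F]_{\psi^{-1}}$; in particular, $\mathbf{E}_q[F]^*_q=\mathbf{e}_{q^{-1}}[F]_{q^{-1}}$.
   Context: For $\phi\in\{\psi,\psi^{-1}\}$: $[n]_\phi=1+\phi+\cdots+\phi^{n-1}$ for $n\ge1$, $[0]_\phi=0$, $[n]_\phi!=[1]_\phi\cdots[n]_\phi$, $[0]_\phi!=1$; for $F\in A[[t]]$, $D_\phi F(t)=\dfrac{F(\phi t)-F(t)}{(\phi-1)t}$. For $F\in A[[t]]$ with $F(0)=0$: $F^{[0]_\phi}=1$ and for $k\ge1$, $F^{[k]_\phi}$ is the unique series with zero constant term such that $D_\phi F^{[k]_\phi}=[k]_\phi F^{[k-1]_\phi}D_\phi F$; similarly $F^{[0]^*_\phi}=1$ and for $k\ge1$, $F^{[k]^*_\phi}$ is the unique series with zero constant term such that $D_\phi F^{[k]^*_\phi}(t)=[k]_\phi\,\phi^{-(k-1)}F^{[k-1]^*_\phi}(\phi t)\,D_\phi F(t)$. For $G(t)=\sum_{k\ge0}a_kt^k\in A[[t]]$,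 define $G[F]_\phi=\sum_{k\ge0}a_kF^{[k]_\phi}$ and $G[F]^*_\phi=\sum_{k\ge0}a_kF^{[k]^*_\phi}$ (these sums converge formally). $\mathbf{e}_\phi(t)=\sum_{n\ge0}t^n/[n]_\phi!$ and $\mathbf{E}_\phi(t)=\sum_{n\ge0}\phi^{\binom n2}t^n/[n]_\phi!$. *)

theory Defs
  imports "HOL-Computational_Algebra.Computational_Algebra"
begin

text \<open>
  Unital commutative algebras over a field. The sort of \<open>'a\<close> is that of commutative rings
  with one, except that it does not demand \<open>0 \<noteq> 1\<close>, so that the zero algebra is not excluded.
\<close>

locale comm_algebra = vector_space scale
  for scale :: "'k::field \<Rightarrow> 'a::{comm_ring, comm_monoid_mult} \<Rightarrow> 'a" (infixr \<open>*s\<close> 75) +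
  assumes scale_mult_left: "(c *s x) * y = c *s (x * y)"

definition qnum :: "'k::field \<Rightarrow> nat \<Rightarrow> 'k" where
  "qnum \<phi> n = (\<Sum>i<n. \<phi> ^ i)"

definition qfact :: "'k::field \<Rightarrow> nat \<Rightarrow> 'k" where
  "qfact \<phi> n = (\<Prod>i=1..n. qnum \<phi> i)"

text \<open>Throughout, \<open>sc\<close> is the action of the scalars \<open>'k\<close> on the coefficient algebra \<open>'a\<close>.\<close>

definition fps_scale :: "('k::field \<Rightarrow> 'a \<Rightarrow> 'a) \<Rightarrow> 'k \<Rightarrow> 'a fps \<Rightarrow> 'a fps" where
  "fps_scale sc c F = Abs_fps (\<lambda>n. sc c (fps_nth F n))"

text \<open>The series \<open>F(\<phi>t)\<close>.\<close>

definition fps_dilate :: "('k::field \<Rightarrow> 'a \<Rightarrow> 'a) \<Rightarrow> 'k \<Rightarrow> 'a fps \<Rightarrow> 'a fps" where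
  "fps_dilate sc \<phi> F = Abs_fps (\<lambda>n. sc (\<phi> ^ n) (fps_nth F n))"

text \<open>
  \<open>D\<^sub>\<phi> F(t) = (F(\<phi>t) - F(t)) / ((\<phi> - 1) t)\<close>. The numerator has zero constant term, so
  \<^const>\<open>fps_shift\<close> is the exact division by \<open>t\<close>. Meaningful only for \<open>\<phi> \<noteq> 1\<close>.
\<close>

definition qderiv ::
    "('k::field \<Rightarrow> 'a::{comm_ring, comm_monoid_mult} \<Rightarrow> 'a) \<Rightarrow> 'k \<Rightarrow> 'a fps \<Rightarrow> 'a fps" where
  "qderiv sc \<phi> F = fps_scale sc (inverse (\<phi> - 1)) (fps_shift 1 (fps_dilate sc \<phi> F - F))"

text \<open>
  The symbolic powers \<open>F\<^bsup>[k]\<^esup>\<close> and \<open>F\<^bsup>[k]*\<^esup>\<close>. That the two definite descriptions are proper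
  when no positive power of \<open>\<phi>\<close> is \<open>1\<close> is shown in \<open>qpow_Suc_ex1\<close> and \<open>qpow_star_Suc_ex1\<close> below.
\<close>

primrec qpow ::
    "('k::field \<Rightarrow> 'a::{comm_ring, comm_monoid_mult} \<Rightarrow> 'a) \<Rightarrow> 'k \<Rightarrow> 'a fps \<Rightarrow> nat \<Rightarrow> 'a fps" where
  "qpow sc \<phi> F 0 = 1"
| "qpow sc \<phi> F (Suc k) = (THE H. fps_nth H 0 = 0 \<and>
     qderiv sc \<phi> H = fps_scale sc (qnum \<phi> (Suc k)) (qpow sc \<phi> F k * qderiv sc \<phi> F))"

primrec qpow_star ::
    "('k::field \<Rightarrow> 'a::{comm_ring, comm_monoid_mult} \<Rightarrow> 'a) \<Rightarrow> 'k \<Rightarrow> 'a fps \<Rightarrow> nat \<Rightarrow> 'a fps" where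
  "qpow_star sc \<phi> F 0 = 1"
| "qpow_star sc \<phi> F (Suc k) = (THE H. fps_nth H 0 = 0 \<and>
     qderiv sc \<phi> H = fps_scale sc (qnum \<phi> (Suc k) * \<phi> powi (- int k))
       (fps_dilate sc \<phi> (qpow_star sc \<phi> F k) * qderiv sc \<phi> F))"

text \<open>
  \<open>G[F]\<close> and \<open>G[F]*\<close>: the sums are taken in the \<open>t\<close>-adic topology on \<^typ>\<open>'a fps\<close>, in which
  they converge (\<open>summable_qcompose\<close>, \<open>summable_qcompose_star\<close> below).
\<close>

definition qcompose ::
    "('k::field \<Rightarrow> 'a::{comm_ring, comm_monoid_mult} \<Rightarrow> 'a) \<Rightarrow> 'k \<Rightarrow> 'a fps \<Rightarrow> 'a fps \<Rightarrow> 'a fps" where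
  "qcompose sc \<phi> G F = (\<Sum>k. fps_const (fps_nth G k) * qpow sc \<phi> F k)"

definition qcompose_star ::
    "('k::field \<Rightarrow> 'a::{comm_ring, comm_monoid_mult} \<Rightarrow> 'a) \<Rightarrow> 'k \<Rightarrow> 'a fps \<Rightarrow> 'a fps \<Rightarrow> 'a fps" where
  "qcompose_star sc \<phi> G F = (\<Sum>k. fps_const (fps_nth G k) * qpow_star sc \<phi> F k)"

text \<open>The two \<open>\<phi>\<close>-exponential series, with coefficients mapped into the algebra.\<close>

definition qexp ::
    "('k::field \<Rightarrow> 'a::{comm_ring, comm_monoid_mult} \<Rightarrow> 'a) \<Rightarrow> 'k \<Rightarrow> 'a fps" where
  "qexp sc \<phi> = Abs_fps (\<lambda>n. sc (1 / qfact \<phi> n) 1)"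

definition qExp ::
    "('k::field \<Rightarrow> 'a::{comm_ring, comm_monoid_mult} \<Rightarrow> 'a) \<Rightarrow> 'k \<Rightarrow> 'a fps" where
  "qExp sc \<phi> = Abs_fps (\<lambda>n. sc (\<phi> ^ (n choose 2) / qfact \<phi> n) 1)"


subsection \<open>Well-definedness\<close>

lemma qnum_nonzero:
  assumes "\<forall>n>0. \<phi> ^ n \<noteq> (1::'k::field)" "n > 0"
  shows "qnum \<phi> n \<noteq> 0"
proof -
  have "(\<phi> - 1) * qnum \<phi> n = \<phi> ^ n - 1"
    unfolding qnum_def by (rule power_diff_1_eq [symmetric])
  with assms show ?thesis by auto
qed

lemma fls_X_powi_power_neq_1:
  assumes "m \<noteq> 0" "n > 0"
  shows "((fls_X :: rat fls) powi m) ^ n \<noteq> 1"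
proof
  assume "((fls_X :: rat fls) powi m) ^ n = 1"
  hence "fls_X powi (m * int n) = (1 :: rat fls)"
    by (simp add: power_int_mult)
  hence "fls_subdegree ((fls_X :: rat fls) powi (m * int n)) = 0"
    by simp
  moreover have "fls_subdegree ((fls_X :: rat fls) powi j) = j" for j :: int
    by (cases "j \<ge> 0") (auto simp: power_int_def fls_subdegree_pow)
  ultimately show False using assms by simp
qed

context comm_algebra
begin

lemma qderiv_nth:
  assumes "\<phi> \<noteq> 1"
  shows "fps_nth (qderiv scale \<phi> H) n = qnum \<phi> (Suc n) *s fps_nth H (Suc n)"
proof -
  have "\<phi> ^ Suc n - 1 = (\<phi> - 1) * qnum \<phi> (Suc n)"
    unfolding qnum_def by (rule power_diff_1_eq)
  hence eq: "inverse (\<phi> - 1) * (\<phi> ^ Suc n - 1) = qnum \<phi> (Suc n)"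
    using assms by (simp add: field_simps)
  have "fps_nth (qderiv scale \<phi> H) n =
          inverse (\<phi> - 1) *s ((\<phi> ^ Suc n - 1) *s fps_nth H (Suc n))"
    by (simp add: qderiv_def fps_scale_def fps_dilate_def scale_left_diff_distrib)
  also have "\<dots> = qnum \<phi> (Suc n) *s fps_nth H (Suc n)"
    by (simp only: scale_scale eq)
  finally show ?thesis .
qed

lemma qderiv_ex1:
  assumes "\<forall>n>0. \<phi> ^ n \<noteq> 1"
  shows "\<exists>!H. fps_nth H 0 = 0 \<and> qderiv scale \<phi> H = P"
proof -
  have [simp]: "\<phi> \<noteq> 1" using assms by (metis power_one_right zero_less_one)
  have nz: "qnum \<phi> (Suc n) \<noteq> 0" for n
    using assms by (intro qnum_nonzero) auto
  show ?thesis
  proof (rule ex1I)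
    let ?H = "Abs_fps (\<lambda>n. case n of 0 \<Rightarrow> 0 | Suc i \<Rightarrow> inverse (qnum \<phi> n) *s fps_nth P i)"
    show "fps_nth ?H 0 = 0 \<and> qderiv scale \<phi> ?H = P"
      by (auto intro!: fps_ext simp: qderiv_nth nz)
  next
    fix H assume H: "fps_nth H 0 = 0 \<and> qderiv scale \<phi> H = P"
    have "fps_nth H n = (case n of 0 \<Rightarrow> 0 | Suc i \<Rightarrow> inverse (qnum \<phi> n) *s fps_nth P i)" for n
      using H by (cases n) (auto simp: qderiv_nth nz)
    thus "H = Abs_fps (\<lambda>n. case n of 0 \<Rightarrow> 0 | Suc i \<Rightarrow> inverse (qnum \<phi> n) *s fps_nth P i)"
      by (intro fps_ext) simp
  qed
qed

lemma qpow_Suc_ex1: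
  assumes "\<forall>n>0. \<phi> ^ n \<noteq> 1"
  shows "\<exists>!H. fps_nth H 0 = 0 \<and>
    qderiv scale \<phi> H = fps_scale scale (qnum \<phi> (Suc k)) (qpow scale \<phi> F k * qderiv scale \<phi> F)"
  by (rule qderiv_ex1[OF assms])

lemma qpow_star_Suc_ex1:
  assumes "\<forall>n>0. \<phi> ^ n \<noteq> 1"
  shows "\<exists>!H. fps_nth H 0 = 0 \<and>
    qderiv scale \<phi> H = fps_scale scale (qnum \<phi> (Suc k) * \<phi> powi (- int k))
      (fps_dilate scale \<phi> (qpow_star scale \<phi> F k) * qderiv scale \<phi> F)"
  by (rule qderiv_ex1[OF assms])

lemma nth_below_if_qderiv:
  assumes "\<forall>n>0. \<phi> ^ n \<noteq> 1"
    and H: "fps_nth H 0 = 0" "qderiv scale \<phi> H = fps_scale scale c (P * Q)"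
    and P: "\<And>i. i < k \<Longrightarrow> fps_nth P i = 0" and "n < Suc k"
  shows "fps_nth H n = 0"
proof (cases n)
  case 0
  thus ?thesis using H by simp
next
  case (Suc i)
  have [simp]: "\<phi> \<noteq> 1" using assms(1) by (metis power_one_right zero_less_one)
  have "fps_nth (P * Q) i = 0"
    using P Suc \<open>n < Suc k\<close> by (auto simp: fps_mult_nth intro!: sum.neutral)
  hence "qnum \<phi> n *s fps_nth H n = 0"
    using arg_cong[OF H(2), of "\<lambda>f. fps_nth f i"] Suc by (simp add: qderiv_nth fps_scale_def)
  moreover have "qnum \<phi> n \<noteq> 0"
    using assms(1) Suc by (intro qnum_nonzero) auto
  ultimately show ?thesis by simp
qed

lemma qpow_Suc:
  assumes "\<forall>n>0. \<phi> ^ n \<noteq> 1"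
  shows "fps_nth (qpow scale \<phi> F (Suc k)) 0 = 0"
    and "qderiv scale \<phi> (qpow scale \<phi> F (Suc k)) =
      fps_scale scale (qnum \<phi> (Suc k)) (qpow scale \<phi> F k * qderiv scale \<phi> F)"
  using theI'[OF qpow_Suc_ex1[OF assms, of k F]] unfolding qpow.simps(2) by blast+

lemma qpow_star_Suc:
  assumes "\<forall>n>0. \<phi> ^ n \<noteq> 1"
  shows "fps_nth (qpow_star scale \<phi> F (Suc k)) 0 = 0"
    and "qderiv scale \<phi> (qpow_star scale \<phi> F (Suc k)) =
      fps_scale scale (qnum \<phi> (Suc k) * \<phi> powi (- int k))
        (fps_dilate scale \<phi> (qpow_star scale \<phi> F k) * qderiv scale \<phi> F)"
  using theI'[OF qpow_star_Suc_ex1[OF assms, of k F]] unfolding qpow_star.simps(2) by blast+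

lemma qpow_nth_below:
  assumes "\<forall>n>0. \<phi> ^ n \<noteq> 1" "n < k"
  shows "fps_nth (qpow scale \<phi> F k) n = 0"
  using assms(2)
proof (induction k arbitrary: n)
  case (Suc k)
  show ?case
    by (rule nth_below_if_qderiv[OF assms(1) qpow_Suc[OF assms(1)] Suc.IH Suc.prems])
qed simp

lemma qpow_star_nth_below:
  assumes "\<forall>n>0. \<phi> ^ n \<noteq> 1" "n < k"
  shows "fps_nth (qpow_star scale \<phi> F k) n = 0"
  using assms(2)
proof (induction k arbitrary: n)
  case (Suc k)
  have "fps_nth (fps_dilate scale \<phi> (qpow_star scale \<phi> F k)) i = 0" if "i < k" for i
    using Suc.IH[OF that] by (simp add: fps_dilate_def)
  from nth_below_if_qderiv[OF assms(1) qpow_star_Suc[OF assms(1)] this Suc.prems]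
  show ?case .
qed simp

end

lemma summable_fps_if_nth_below:
  fixes f :: "nat \<Rightarrow> 'a::ab_group_add fps"
  assumes "\<And>n k. n < k \<Longrightarrow> fps_nth (f k) n = 0"
  shows "summable f"
  unfolding summable_def sums_def
proof (intro exI tendsto_fpsI)
  fix n
  have "fps_nth (\<Sum>k<N. f k) n = fps_nth (Abs_fps (\<lambda>n. \<Sum>k\<le>n. fps_nth (f k) n)) n"
    if "N > n" for N
    using that assms by (auto simp: fps_sum_nth intro!: sum.mono_neutral_right intro: leI)
  thus "\<forall>\<^sub>F N in sequentially.
      fps_nth (\<Sum>k<N. f k) n = fps_nth (Abs_fps (\<lambda>n. \<Sum>k\<le>n. fps_nth (f k) n)) n"
    by (intro eventually_mono[OF eventually_gt_at_top[of n]]) auto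
qed

context comm_algebra
begin

lemma summable_qcompose:
  assumes "\<forall>n>0. \<phi> ^ n \<noteq> 1"
  shows "summable (\<lambda>k. fps_const (fps_nth G k) * qpow scale \<phi> F k)"
  by (rule summable_fps_if_nth_below) (simp add: qpow_nth_below assms)

lemma summable_qcompose_star:
  assumes "\<forall>n>0. \<phi> ^ n \<noteq> 1"
  shows "summable (\<lambda>k. fps_const (fps_nth G k) * qpow_star scale \<phi> F k)"
  by (rule summable_fps_if_nth_below) (simp add: qpow_star_nth_below assms)

end

end

theory Submission
  imports Defs
begin

text \<open>
  Substituting \<open>\<psi>t\<close> for \<open>t\<close> turns \<open>D\<^bsub>1/\<psi>\<^esub> H\<close> into \<open>D\<^sub>\<psi> H\<close>. Since
  \<open>[k]\<^bsub>1/\<psi>\<^esub> = \<psi>\<^bsup>-(k-1)\<^esup> [k]\<^sub>\<psi>\<close>, the same substitution turns the equation defining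
  \<open>F\<^bsup>[k]\<^esup>\<close> at \<open>1/\<psi>\<close> into the one defining \<open>F\<^bsup>[k]*\<^esup>\<close> at \<open>\<psi>\<close>, and the two symbolic powers
  agree by uniqueness. Likewise \<open>[n]\<^bsub>1/\<psi>\<^esub>! = \<psi>\<^bsup>-(n choose 2)\<^esup> [n]\<^sub>\<psi>!\<close>, so the two exponential
  series coincide.
\<close>

text \<open>The factor \<open>\<psi> ^ n\<close> reverses the geometric sum: the term of index
  \<open>i\<close> becomes \<open>\<psi> ^ (n - i)\<close>.\<close>

lemma qnum_inverse:
  fixes \<psi> :: "'k::field"
  assumes "\<psi> \<noteq> 0"
  shows "\<psi> ^ n * qnum (inverse \<psi>) (Suc n) = qnum \<psi> (Suc n)"
proof -
  have "\<psi> ^ n * qnum (inverse \<psi>) (Suc n) = (\<Sum>i<Suc n. \<psi> ^ (Suc n - Suc i))"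
    unfolding qnum_def sum_distrib_left
    by (intro sum.cong) (auto simp: power_diff assms power_inverse field_simps)
  also have "\<dots> = qnum \<psi> (Suc n)"
    unfolding qnum_def by (rule sum.nat_diff_reindex)
  finally show ?thesis .
qed

lemma qfact_inverse:
  fixes \<psi> :: "'k::field"
  assumes "\<psi> \<noteq> 0"
  shows "\<psi> ^ (n choose 2) * qfact (inverse \<psi>) n = qfact \<psi> n"
proof (induction n)
  case 0
  show ?case by (simp add: qfact_def binomial_eq_0)
next
  case (Suc n)
  have fact_Suc: "qfact \<phi> (Suc n) = qfact \<phi> n * qnum \<phi> (Suc n)" for \<phi> :: 'k
    by (simp add: qfact_def)
  \<comment> \<open>Pascal's rule splits off exactly the factor \<open>\<psi> ^ n\<close> that
    \<open>qnum_inverse\<close> absorbs.\<close>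
  have "Suc n choose 2 = n + (n choose 2)"
    by (simp add: numeral_2_eq_2)
  hence "\<psi> ^ (Suc n choose 2) * qfact (inverse \<psi>) (Suc n) =
      (\<psi> ^ (n choose 2) * qfact (inverse \<psi>) n) * (\<psi> ^ n * qnum (inverse \<psi>) (Suc n))"
    by (simp add: fact_Suc power_add mult_ac)
  also have "\<dots> = qfact \<psi> (Suc n)"
    by (simp only: Suc.IH qnum_inverse[OF assms] fact_Suc)
  finally show ?case .
qed

context comm_algebra
begin

lemma scale_mult_right: "x * (c *s y) = c *s (x * y)"
  by (metis mult.commute scale_mult_left)

text \<open>In degree \<open>n\<close> of the Cauchy product, \<open>\<phi> ^ n\<close> splits as
  \<open>\<phi> ^ i * \<phi> ^ (n - i)\<close>.\<close>

lemma fps_dilate_mult: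
  "fps_dilate scale \<phi> (P * Q) = fps_dilate scale \<phi> P * fps_dilate scale \<phi> Q"
proof (rule fps_ext)
  fix n
  show "fps_nth (fps_dilate scale \<phi> (P * Q)) n =
      fps_nth (fps_dilate scale \<phi> P * fps_dilate scale \<phi> Q) n"
    by (auto simp: fps_dilate_def fps_mult_nth scale_sum_right scale_mult_left
        scale_mult_right simp flip: power_add intro!: sum.cong)
qed

lemma fps_dilate_scale:
  "fps_dilate scale \<phi> (fps_scale scale c P) = fps_scale scale c (fps_dilate scale \<phi> P)"
  by (simp add: fps_dilate_def fps_scale_def mult.commute)

text \<open>In degree \<open>n\<close> the dilation contributes \<open>\<psi> ^ n\<close>, which
  turns \<open>qnum (inverse \<psi>) (Suc n)\<close> into
  \<open>qnum \<psi> (Suc n)\<close>.\<close>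

lemma fps_dilate_qderiv_inverse:
  assumes "\<psi> \<noteq> 0" "\<psi> \<noteq> 1"
  shows "fps_dilate scale \<psi> (qderiv scale (inverse \<psi>) H) = qderiv scale \<psi> H"
proof (rule fps_ext)
  fix n
  have "inverse \<psi> \<noteq> 1" using assms by simp
  thus "fps_nth (fps_dilate scale \<psi> (qderiv scale (inverse \<psi>) H)) n =
      fps_nth (qderiv scale \<psi> H) n"
    using assms by (simp add: fps_dilate_def qderiv_nth qnum_inverse)
qed

lemma qpow_star_eq_qpow_inverse:
  assumes nz: "\<psi> \<noteq> 0" and ord: "\<forall>n>0. \<psi> ^ n \<noteq> 1"
  shows "qpow_star scale \<psi> F k = qpow scale (inverse \<psi>) F k"
proof (induction k)
  case (Suc k)
  let ?H = "qpow scale (inverse \<psi>) F (Suc k)"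
  \<comment> \<open>This makes the definite description behind \<open>?H\<close> proper, so that
    \<open>qpow_Suc\<close> applies at \<open>inverse \<psi>\<close>.\<close>
  have ord': "\<forall>n>0. inverse \<psi> ^ n \<noteq> 1"
    using ord by (simp add: power_inverse)
  have ne1: "\<psi> \<noteq> 1" using ord by (metis power_one_right zero_less_one)
  have num: "qnum (inverse \<psi>) (Suc k) = qnum \<psi> (Suc k) * \<psi> powi (- int k)"
    using nz by (simp add: power_int_minus field_simps flip: qnum_inverse[of \<psi> k])
  have "qderiv scale \<psi> ?H = fps_dilate scale \<psi> (qderiv scale (inverse \<psi>) ?H)"
    by (rule fps_dilate_qderiv_inverse[OF nz ne1, symmetric])
  also have "\<dots> = fps_scale scale (qnum \<psi> (Suc k) * \<psi> powi (- int k))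
      (fps_dilate scale \<psi> (qpow_star scale \<psi> F k) * qderiv scale \<psi> F)"
    by (simp only: qpow_Suc(2)[OF ord'] fps_dilate_scale fps_dilate_mult
        fps_dilate_qderiv_inverse[OF nz ne1] num Suc.IH)
  finally show ?case
    using qpow_star_Suc_ex1[OF ord, of k F] qpow_Suc(1)[OF ord'] qpow_star_Suc[OF ord]
    by blast
qed simp

lemma qcompose_star_eq_qcompose_inverse:
  assumes "\<psi> \<noteq> 0" "\<forall>n>0. \<psi> ^ n \<noteq> 1"
  shows "qcompose_star scale \<psi> G F = qcompose scale (inverse \<psi>) G F"
  using assms by (simp add: qcompose_star_def qcompose_def qpow_star_eq_qpow_inverse)

lemma qExp_eq_qexp_inverse:
  assumes "\<psi> \<noteq> 0"
  shows "qExp scale \<psi> = qexp scale (inverse \<psi>)"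
proof -
  \<comment> \<open>The power of \<open>\<psi>\<close> cancels even if the factorials vanish, as
    both quotients are then 0.\<close>
  have "\<psi> ^ (n choose 2) / qfact \<psi> n = 1 / qfact (inverse \<psi>) n" for n
    using assms by (simp flip: qfact_inverse[of \<psi> n])
  thus ?thesis by (simp add: qExp_def qexp_def)
qed

end

theorem theorem7p1:
  fixes scale :: "rat fls \<Rightarrow> 'a::{comm_ring, comm_monoid_mult} \<Rightarrow> 'a"
    and F :: "'a fps" and m :: int and q \<psi> :: "rat fls"
  assumes "comm_algebra scale"
    and "fps_nth F 0 = 0"
    and "m \<noteq> 0"
    and "q = fls_X"
    and "\<psi> = q powi m"
  shows "(\<forall>k. qpow_star scale \<psi> F k = qpow scale (inverse \<psi>) F k) \<and>
    (\<forall>G. qcompose_star scale \<psi> G F = qcompose scale (inverse \<psi>) G F) \<and>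
    qcompose_star scale \<psi> (qExp scale \<psi>) F
      = qcompose scale (inverse \<psi>) (qexp scale (inverse \<psi>)) F \<and>
    qcompose_star scale q (qExp scale q) F
      = qcompose scale (inverse q) (qexp scale (inverse q)) F"
proof -
  interpret comm_algebra scale by fact
  have q: "q \<noteq> 0" "\<forall>n>0. q ^ n \<noteq> 1"
    \<comment> \<open>The special case at \<open>q\<close> is the exponent 1.\<close>
    using fls_X_powi_power_neq_1[of 1] by (simp_all add: assms(4))
  have \<psi>: "\<psi> \<noteq> 0" "\<forall>n>0. \<psi> ^ n \<noteq> 1"
    using fls_X_powi_power_neq_1[OF assms(3)] by (simp_all add: assms(4,5))
  show ?thesis
    by (simp add: q \<psi> qpow_star_eq_qpow_inverse qcompose_star_eq_qcompose_inverse
        qExp_eq_qexp_inverse)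
qed

end
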